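(* Let $(X,X_+,\mathcal{K},f)$ be a strong abstract state space, and let $P$ be a Markov projection on $X$. Let $T:X\to X$ be a Markov operator with $PT=TP$ and $TP=P$. Suppose $T$ satisfies condition $\mathfrak{D}_P^*$: there exist a constant $\lambda\in(1/2,1]$, an integer $n_0\in\mathbb{N}$ (with $n_0\geq1$) and a Markov projection $Q$ on $X$ with $Q=QP=PQ$ such that for every $x\in\mathcal{K}$ there exists $u_x\in X_+$ with $\|u_x\|\ge\lambda$ and $$T^{n_0}x\ge u_x,\qquad Qx\ge u_x.$$ Then $T$ is uniformly $P$-ergodic, i.e. $\lim_{n\to\infty}\|T^n-P\|=0$.
   Context: Abstract state space: let $X\neq\{0\}$ be a real ordered vector space with cone $X_+=\{x\in X: x\ge 0\}$ which is generating ($X=X_+-X_+$), let $f$ be a strictly positive linear functional on $X$ ($f(x)>0$ for $x\ge 0$, $x\ne 0$), and let $\mathcal{K}=\{x\in X_+: f(x)=1\}$. Let $U$ be the convex hull of $\mathcal{K}\cup(-\mathcal{K})$ and $\|x\|=\inf\{\lambda\ge 0: x\in\lambda U\}$. $(X,X_+,\mathcal{K},f)$ is an abstract state space if this seminorm is a norm, $X$ is complete for it, and $X_+$ is closed. It is a strong abstract state space if in addition $U$ is radially compact, i.e. $\ell\cap U$ is a closed and bounded segment for every line $\ell$ through the origin; equivalently, $U$ coincides with the closed unit ball of $X$. A Markov operator on $X$ is a linear operator $T:X\to X$ that is positive ($Tx\ge0$ for $x\ge0$) and satisfies $T(\mathcal{K})\subset\mathcal{K}$. A Markov projection is a Markov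 operator $P$ with $P^2=P$. *)

theory Defs
  imports "HOL-Analysis.Analysis"
begin

definition base_set :: "('a::ordered_real_vector \<Rightarrow> real) \<Rightarrow> 'a set" where
  "base_set f = {x. 0 \<le> x \<and> f x = 1}"

definition base_ball :: "('a::ordered_real_vector \<Rightarrow> real) \<Rightarrow> 'a set" where
  "base_ball f = convex hull (base_set f \<union> uminus ` base_set f)"

definition base_seminorm :: "('a::ordered_real_vector \<Rightarrow> real) \<Rightarrow> 'a \<Rightarrow> real" where
  "base_seminorm f x = Inf {l. 0 \<le> l \<and> x \<in> (\<lambda>u. l *\<^sub>R u) ` base_ball f}"

definition radially_compact :: "'a::real_vector set \<Rightarrow> bool" where
  "radially_compact U \<longleftrightarrow> (\<forall>x. x \<noteq> 0 \<longrightarrow> (\<exists>a b. span {x} \<inter> U = closed_segment a b))"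

text \<open>The order of the type carries the cone \<open>{x. 0 \<le> x}\<close>. That the base seminorm is a norm
  and that the space is complete for it is expressed by identifying it with the norm of the
  class \<open>banach\<close>, so that \<open>closed\<close>, \<open>norm\<close> and \<open>onorm\<close> all refer to the base norm.\<close>

locale abstract_state_space =
  fixes f :: "'a::{banach, ordered_real_vector} \<Rightarrow> real"
  assumes nontrivial: "\<exists>x::'a. x \<noteq> 0"
    and generating: "\<forall>x::'a. \<exists>y z. 0 \<le> y \<and> 0 \<le> z \<and> x = y - z"
    and linear_functional: "linear f"
    and strictly_positive: "\<forall>x. 0 \<le> x \<and> x \<noteq> 0 \<longrightarrow> 0 < f x"
    and norm_eq_base_seminorm: "\<forall>x. norm x = base_seminorm f x"
    and closed_cone: "closed {x::'a. 0 \<le> x}"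

locale strong_abstract_state_space = abstract_state_space +
  assumes radially_compact_base_ball: "radially_compact (base_ball f)"

definition markov_operator ::
    "('a::ordered_real_vector \<Rightarrow> real) \<Rightarrow> ('a \<Rightarrow> 'a) \<Rightarrow> bool" where
  "markov_operator f T \<longleftrightarrow>
     linear T \<and> (\<forall>x. 0 \<le> x \<longrightarrow> 0 \<le> T x) \<and> T ` base_set f \<subseteq> base_set f"

definition markov_projection ::
    "('a::ordered_real_vector \<Rightarrow> real) \<Rightarrow> ('a \<Rightarrow> 'a) \<Rightarrow> bool" where
  "markov_projection f P \<longleftrightarrow> markov_operator f P \<and> P \<circ> P = P"

definition condition_D_star ::
    "('a::{banach, ordered_real_vector} \<Rightarrow> real) \<Rightarrow> ('a \<Rightarrow> 'a) \<Rightarrow> ('a \<Rightarrow> 'a) \<Rightarrow> bool" where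
  "condition_D_star f P T \<longleftrightarrow>
     (\<exists>(l::real) (n0::nat) Q. 1/2 < l \<and> l \<le> 1 \<and> 1 \<le> n0 \<and>
        markov_projection f Q \<and> Q = Q \<circ> P \<and> Q = P \<circ> Q \<and>
        (\<forall>x \<in> base_set f. \<exists>u. 0 \<le> u \<and> l \<le> norm u \<and> u \<le> (T ^^ n0) x \<and> u \<le> Q x))"

text \<open>Markov operators are contractions for the base norm, hence \<open>onorm\<close> is here the
  genuine operator norm (the supremum defining it is of a bounded set).\<close>

definition uniformly_P_ergodic ::
    "('a::real_normed_vector \<Rightarrow> 'a) \<Rightarrow> ('a \<Rightarrow> 'a) \<Rightarrow> bool" where
  "uniformly_P_ergodic P T \<longleftrightarrow> (\<lambda>n. onorm (\<lambda>x. (T ^^ n) x - P x)) \<longlonglongrightarrow> 0"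

end

theory Submission
  imports Defs
begin

text \<open>Every \<open>x\<close> is a difference \<open>y - z\<close> of positive elements with \<open>f y + f z\<close> arbitrarily close
  to \<open>norm x\<close>. If \<open>P x = 0\<close>, then \<open>f x = 0\<close>, so \<open>f y = f z\<close>, and \<open>Q x = Q (P x) = 0\<close>. Writing
  \<open>T\<^sup>n\<^sup>0 x = (T\<^sup>n\<^sup>0 - Q) y - (T\<^sup>n\<^sup>0 - Q) z\<close> and cancelling the common lower bounds \<open>u\<close> in each
  term shows that \<open>T\<^sup>n\<^sup>0\<close> contracts the kernel of \<open>P\<close> by the factor \<open>2 (1 - \<lambda>) < 1\<close>. Since
  \<open>T\<^sup>n - P = T\<^sup>n (1 - P)\<close> and \<open>1 - P\<close> maps into that kernel, the convergence is geometric.\<close>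

context abstract_state_space
begin

section \<open>The cone, its base and the base norm\<close>

lemma functional_nonneg: "0 \<le> x \<Longrightarrow> 0 \<le> f x"
  using strictly_positive linear_0[OF linear_functional] by (cases "x = 0") (auto simp: less_imp_le)

lemma base_set_normalized:
  assumes "0 \<le> x" "x \<noteq> 0"
  shows "(1 / f x) *\<^sub>R x \<in> base_set f"
proof -
  have "0 < f x" using assms strictly_positive by blast
  then show ?thesis
    using assms by (simp add: base_set_def linear_scale[OF linear_functional] scaleR_nonneg_nonneg)
qed

lemma base_set_nonempty: "base_set f \<noteq> {}"
proof -
  obtain x :: 'a where "x \<noteq> 0" using nontrivial by blast
  moreover obtain y z where "0 \<le> y" "0 \<le> z" "x = y - z" using generating by blast
  ultimately have "0 \<le> y \<and> y \<noteq> 0 \<or> 0 \<le> z \<and> z \<noteq> 0" by auto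
  then show ?thesis using base_set_normalized by blast
qed

lemma nonneg_base_set_scale:
  assumes "0 \<le> x"
  obtains k where "k \<in> base_set f" "x = f x *\<^sub>R k"
proof (cases "x = 0")
  case True
  then show ?thesis using that base_set_nonempty linear_0[OF linear_functional] by force
next
  case False
  then have "0 < f x" using assms strictly_positive by blast
  with that[OF base_set_normalized[OF assms False]] show ?thesis by simp
qed

text \<open>The differences of total mass 1 form a convex set containing the base and its negative,
  so minimality of the convex hull applies.\<close>

lemma base_ball_decompose:
  assumes "u \<in> base_ball f"
  shows "\<exists>y z. 0 \<le> y \<and> 0 \<le> z \<and> u = y - z \<and> f y + f z = 1"
proof -
  let ?D = "{u. \<exists>y z. 0 \<le> y \<and> 0 \<le> z \<and> u = y - z \<and> f y + f z = 1}"
  have "convex ?D"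
  proof (rule convexI)
    fix x y and s t :: real
    assume st: "0 \<le> s" "0 \<le> t" "s + t = 1" and "x \<in> ?D" "y \<in> ?D"
    then obtain a b c d where *: "0 \<le> a" "0 \<le> b" "x = a - b" "f a + f b = 1"
      "0 \<le> c" "0 \<le> d" "y = c - d" "f c + f d = 1" by blast
    have "s *\<^sub>R x + t *\<^sub>R y = (s *\<^sub>R a + t *\<^sub>R c) - (s *\<^sub>R b + t *\<^sub>R d)"
      unfolding *(3,7) by (simp add: algebra_simps)
    moreover have "0 \<le> s *\<^sub>R a + t *\<^sub>R c" "0 \<le> s *\<^sub>R b + t *\<^sub>R d"
      using * st by (simp_all add: add_nonneg_nonneg scaleR_nonneg_nonneg)
    \<comment> \<open>Total mass is affine under this combination: two pairs of mass 1 with weights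
      \<open>s + t = 1\<close> again give mass 1.\<close>
    moreover have "f (s *\<^sub>R a + t *\<^sub>R c) + f (s *\<^sub>R b + t *\<^sub>R d) = s * (f a + f b) + t * (f c + f d)"
      by (simp add: linear_add[OF linear_functional] linear_scale[OF linear_functional] algebra_simps)
    ultimately show "s *\<^sub>R x + t *\<^sub>R y \<in> ?D"
      using *(4,8) st(3) by (simp only: mult_1_right) blast
  qed
  moreover have "base_set f \<union> uminus ` base_set f \<subseteq> ?D"
  proof -
    have pos: "k \<in> ?D" if "k \<in> base_set f" for k
      using that by (intro CollectI exI[of _ k] exI[of _ 0]) (simp add: base_set_def linear_0[OF linear_functional])
    have neg: "- k \<in> ?D" if "k \<in> base_set f" for k
      using that by (intro CollectI exI[of _ 0] exI[of _ k]) (simp add: base_set_def linear_0[OF linear_functional])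
    show ?thesis by (intro Un_least subsetI image_subsetI) (fact pos neg)+
  qed
  ultimately have "base_ball f \<subseteq> ?D"
    unfolding base_ball_def by (intro hull_minimal)
  from subsetD[OF this assms] show ?thesis by (rule CollectD)
qed

text \<open>Converse direction: normalizing \<open>y\<close> and \<open>z\<close> to base elements
  \<open>k\<close> and \<open>m\<close> turns \<open>y - z\<close> into a multiple of a convex
  combination of \<open>k\<close> and \<open>- m\<close>.\<close>

lemma diff_in_scaled_base_ball:
  assumes "0 \<le> y" "0 \<le> z"
  shows "y - z \<in> (\<lambda>u. (f y + f z) *\<^sub>R u) ` base_ball f"
proof -
  obtain k where k: "k \<in> base_set f" "y = f y *\<^sub>R k" using nonneg_base_set_scale[OF assms(1)] .
  obtain m where m: "m \<in> base_set f" "z = f z *\<^sub>R m" using nonneg_base_set_scale[OF assms(2)] .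
  have km: "k \<in> base_ball f" "- m \<in> base_ball f"
    unfolding base_ball_def using k m by (auto intro: hull_inc)
  have fyz: "0 \<le> f y" "0 \<le> f z" using assms functional_nonneg by auto
  show ?thesis
  proof (cases "f y + f z = 0")
    \<comment> \<open>No normalization by the total mass is possible here, but both vectors vanish,
      and 0 is the zero multiple of any point of the ball.\<close>
    case True
    then have "f y = 0" "f z = 0" using fyz by auto
    then have "y = 0" "z = 0" using k m by auto
    then show ?thesis using km by (auto intro!: image_eqI[of _ _ k] simp: linear_0[OF linear_functional])
  next
    case False
    define s where "s = f y + f z"
    have s: "0 < s" using False fyz unfolding s_def by linarith
    have "(f y / s) *\<^sub>R k + (f z / s) *\<^sub>R (- m) \<in> base_ball f"
    proof (rule convexD[OF _ km])
      show "convex (base_ball f)" by (simp add: base_ball_def)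
      show "f y / s + f z / s = 1" using s by (simp add: s_def flip: add_divide_distrib)
    qed (use fyz s in auto)
    moreover have "s *\<^sub>R ((f y / s) *\<^sub>R k + (f z / s) *\<^sub>R (- m)) = f y *\<^sub>R k - f z *\<^sub>R m"
      using s by (simp add: scaleR_diff_right)
    ultimately show ?thesis using k(2) m(2) unfolding s_def[symmetric] by (metis image_eqI)
  qed
qed

text \<open>Taking the second part of the difference to be 0 makes \<open>f x\<close> an admissible
  scale in the infimum. This turns order estimates into norm estimates.\<close>

lemma norm_le_functional:
  assumes "0 \<le> x"
  shows "norm x \<le> f x"
proof -
  have "x \<in> (\<lambda>u. f x *\<^sub>R u) ` base_ball f"
    using diff_in_scaled_base_ball[OF assms order_refl] linear_0[OF linear_functional] by simp
  then have "base_seminorm f x \<le> f x"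
    unfolding base_seminorm_def
    by (intro cInf_lower) (auto intro!: bdd_belowI[of _ 0] simp: functional_nonneg assms)
  then show ?thesis using norm_eq_base_seminorm by simp
qed

text \<open>The norm is an infimum of scales \<open>l\<close>, so some \<open>l\<close> lies within
  \<open>e\<close> of it; splitting the point of the ball and rescaling by \<open>l\<close> gives
  masses of sum \<open>l\<close>.\<close>

lemma decompose_near_norm:
  assumes "0 < e"
  obtains y z where "0 \<le> y" "0 \<le> z" "x = y - z" "f y + f z \<le> norm x + e"
proof -
  let ?L = "{l. 0 \<le> l \<and> x \<in> (\<lambda>u. l *\<^sub>R u) ` base_ball f}"
  obtain y z where "0 \<le> y" "0 \<le> z" "x = y - z" using generating by blast
  then have "f y + f z \<in> ?L"
    using diff_in_scaled_base_ball[of y z] functional_nonneg[of y] functional_nonneg[of z] by auto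
  \<comment> \<open>Without an element of \<open>?L\<close>, the infimum would say nothing about
    scales; the generating cone supplies one.\<close>
  then have "?L \<noteq> {}" by blast
  moreover have "Inf ?L < norm x + e"
    using norm_eq_base_seminorm assms by (simp add: base_seminorm_def)
  ultimately obtain l u where l: "0 \<le> l" "l < norm x + e" and u: "x = l *\<^sub>R u" "u \<in> base_ball f"
    using cInf_lessD[of ?L "norm x + e"] by blast
  obtain a b where ab: "0 \<le> a" "0 \<le> b" "u = a - b" "f a + f b = 1"
    using base_ball_decompose[OF u(2)] by blast
  show ?thesis
  proof (rule that)
    show "x = l *\<^sub>R a - l *\<^sub>R b" using u ab by (simp add: scaleR_diff_right)
    have "f (l *\<^sub>R a) + f (l *\<^sub>R b) = l * (f a + f b)"
      by (simp add: linear_scale[OF linear_functional] algebra_simps)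
    then show "f (l *\<^sub>R a) + f (l *\<^sub>R b) \<le> norm x + e" using l ab by simp
  qed (use l ab in \<open>auto intro: scaleR_nonneg_nonneg\<close>)
qed

text \<open>Reduces norm estimates for \<open>A\<close> to estimates on positive parts, since
  \<open>f y + f z\<close> can be brought arbitrarily close to \<open>norm x\<close>.\<close>

lemma norm_image_le:
  assumes "linear A"
    and bound: "\<And>y z. 0 \<le> y \<Longrightarrow> 0 \<le> z \<Longrightarrow> x = y - z \<Longrightarrow> norm (A x) \<le> c * (f y + f z)"
    and "0 \<le> c"
  shows "norm (A x) \<le> c * norm x"
proof (rule field_le_epsilon)
  fix e :: real assume "0 < e"
  \<comment> \<open>Dividing by \<open>c + 1\<close> keeps the slack defined for
    \<open>c = 0\<close>, and \<open>c * e / (c + 1) \<le> e\<close>.\<close>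
  then have "0 < e / (c + 1)" using \<open>0 \<le> c\<close> by simp
  then obtain y z where yz: "0 \<le> y" "0 \<le> z" "x = y - z" "f y + f z \<le> norm x + e / (c + 1)"
    by (rule decompose_near_norm)
  have "norm (A x) \<le> c * (f y + f z)" using bound yz by blast
  also have "\<dots> \<le> c * (norm x + e / (c + 1))" using yz(4) \<open>0 \<le> c\<close> by (rule mult_left_mono)
  also have "\<dots> \<le> c * norm x + e" using \<open>0 \<le> c\<close> \<open>0 < e\<close> by (simp add: field_simps)
  finally show "norm (A x) \<le> c * norm x + e" .
qed

section \<open>Markov operators preserve mass and contract the norm\<close>

lemma markov_functional_nonneg:
  assumes "markov_operator f T" "0 \<le> x"
  shows "f (T x) = f x"
proof -
  have lin: "linear T" and "T ` base_set f \<subseteq> base_set f"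
    using assms by (auto simp: markov_operator_def)
  moreover obtain k where k: "k \<in> base_set f" "x = f x *\<^sub>R k"
    using nonneg_base_set_scale[OF assms(2)] .
  ultimately have "f (T k) = 1" by (auto simp: base_set_def)
  moreover have "T x = f x *\<^sub>R T k" using k(2) linear_scale[OF lin] by metis
  ultimately show ?thesis by (simp add: linear_scale[OF linear_functional])
qed

lemma markov_functional:
  assumes "markov_operator f T"
  shows "f (T x) = f x"
proof -
  obtain y z where "0 \<le> y" "0 \<le> z" "x = y - z" using generating by blast
  moreover have "linear T" using assms by (simp add: markov_operator_def)
  ultimately show ?thesis
    using markov_functional_nonneg[OF assms]
    by (simp add: linear_diff[of T] linear_diff[OF linear_functional])
qed

lemma markov_contraction:
  assumes "markov_operator f T"
  shows "norm (T x) \<le> norm x"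
proof -
  have lin: "linear T" and pos: "\<And>x. 0 \<le> x \<Longrightarrow> 0 \<le> T x"
    using assms by (auto simp: markov_operator_def)
  have "norm (T x) \<le> 1 * norm x"
  proof (rule norm_image_le[OF lin])
    fix y z assume yz: "0 \<le> y" "0 \<le> z" "x = y - z"
    have "norm (T x) \<le> norm (T y) + norm (T z)"
      using yz linear_diff[OF lin] norm_triangle_ineq4 by metis
    also have "\<dots> \<le> f (T y) + f (T z)" using yz by (intro add_mono norm_le_functional pos)
    finally show "norm (T x) \<le> 1 * (f y + f z)" by (simp add: markov_functional[OF assms])
  qed simp
  then show ?thesis by simp
qed

lemma markov_funpow:
  assumes "markov_operator f T"
  shows "markov_operator f (T ^^ n)"
proof (induction n)
  case 0
  then show ?case by (simp add: markov_operator_def linear_id[unfolded id_def] id_def)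
next
  case (Suc n)
  then show ?case
    using assms linear_compose[of "T ^^ n" T]
    by (auto simp: markov_operator_def image_subset_iff comp_def)
qed

text \<open>Where \<open>Q x = 0\<close>, \<open>S\<close> agrees with \<open>S - Q\<close>. The
  bound for \<open>S - Q\<close> on the base passes to the cone by homogeneity and to the whole
  space through decompositions.\<close>

lemma common_lower_bound_contraction:
  assumes S: "markov_operator f S" and Q: "markov_operator f Q"
    and l: "l \<le> 1"
    and minor: "\<And>x. x \<in> base_set f \<Longrightarrow> \<exists>u. 0 \<le> u \<and> l \<le> norm u \<and> u \<le> S x \<and> u \<le> Q x"
    and x: "f x = 0" "Q x = 0"
  shows "norm (S x) \<le> 2 * (1 - l) * norm x"
proof -
  let ?A = "\<lambda>x. S x - Q x"
  have linS: "linear S" and linQ: "linear Q" using S Q by (auto simp: markov_operator_def)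
  then have linA: "linear ?A" by (intro linear_compose_sub)
  have base: "norm (?A k) \<le> 2 * (1 - l)" if k: "k \<in> base_set f" for k
  proof -
    obtain u where u: "0 \<le> u" "l \<le> norm u" "u \<le> S k" "u \<le> Q k" using minor[OF k] by blast
    have fk: "f k = 1" using k by (simp add: base_set_def)
    \<comment> \<open>A lower bound on the norm of \<open>u\<close> is also one on its mass. Each
      positive remainder \<open>S k - u\<close>, \<open>Q k - u\<close> therefore has mass, hence
      norm, at most \<open>1 - l\<close>.\<close>
    have "l \<le> f u" using u norm_le_functional[of u] by linarith
    moreover have "norm (S k - u) \<le> f (S k) - f u" "norm (Q k - u) \<le> f (Q k) - f u"
      using u norm_le_functional[of "S k - u"] norm_le_functional[of "Q k - u"]
      by (simp_all add: linear_diff[OF linear_functional])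
    moreover have "norm (?A k) \<le> norm (S k - u) + norm (Q k - u)"
      using norm_triangle_ineq4[of "S k - u" "Q k - u"] by simp
    ultimately show ?thesis
      using markov_functional[OF S] markov_functional[OF Q] fk by auto
  qed
  have cone: "norm (?A y) \<le> 2 * (1 - l) * f y" if y: "0 \<le> y" for y
  proof -
    obtain k where k: "k \<in> base_set f" "y = f y *\<^sub>R k" using nonneg_base_set_scale[OF y] .
    have "?A y = f y *\<^sub>R ?A k"
      using k(2) linear_scale[OF linA] by metis
    then have "norm (?A y) = f y * norm (?A k)" using functional_nonneg[OF y] by simp
    then show ?thesis
      using mult_left_mono[OF base[OF k(1)] functional_nonneg[OF y]] by (simp add: mult.commute)
  qed
  have "norm (?A x) \<le> 2 * (1 - l) * norm x"
  proof (rule norm_image_le[OF linA])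
    fix y z assume yz: "0 \<le> y" "0 \<le> z" "x = y - z"
    have "norm (?A x) \<le> norm (?A y) + norm (?A z)"
      using yz linear_diff[OF linA] norm_triangle_ineq4 by metis
    also have "\<dots> \<le> 2 * (1 - l) * (f y + f z)"
      using cone yz by (simp add: distrib_left add_mono)
    finally show "norm (?A x) \<le> 2 * (1 - l) * (f y + f z)" .
  qed (use l in simp)
  then show ?thesis using x by simp
qed

end

theorem theorem4p3:
  fixes f :: "'a::{banach, ordered_real_vector} \<Rightarrow> real"
    and P T :: "'a \<Rightarrow> 'a"
  assumes "strong_abstract_state_space f"
    and "markov_projection f P"
    and "markov_operator f T"
    and "P \<circ> T = T \<circ> P"
    and "T \<circ> P = P"
    and "condition_D_star f P T"
  shows "uniformly_P_ergodic P T"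
proof -
  interpret strong_abstract_state_space f by fact
  have P: "markov_operator f P" and PP: "\<And>x. P (P x) = P x"
    using assms(2) by (auto simp: markov_projection_def fun_eq_iff)
  have linP: "linear P" using P by (simp add: markov_operator_def)
  have linTn: "linear (T ^^ n)" for n
    using markov_funpow[OF assms(3)] by (simp add: markov_operator_def)
  \<comment> \<open>Powers of \<open>T\<close> fix the range of \<open>P\<close>, which gives
    \<open>T^n - P = T^n (1 - P)\<close>.\<close>
  have TnP: "(T ^^ n) (P x) = P x" for n x
    using assms(5) by (induction n) (auto simp: fun_eq_iff)
  \<comment> \<open>Powers of \<open>T\<close> leave the kernel of \<open>P\<close> invariant, so
    the one-step contraction there can be iterated.\<close>
  have PTn: "P ((T ^^ n) x) = P x" for n x
    using assms(4,5) by (induction n) (auto simp: fun_eq_iff)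
  obtain l n0 Q where D: "1/2 < l \<and> l \<le> 1 \<and> 1 \<le> n0 \<and> markov_projection f Q \<and> Q = Q \<circ> P \<and> Q = P \<circ> Q \<and>
      (\<forall>x \<in> base_set f. \<exists>u. 0 \<le> u \<and> l \<le> norm u \<and> u \<le> (T ^^ n0) x \<and> u \<le> Q x)"
    using assms(6) unfolding condition_D_star_def by (elim exE) (rule that)
  have l: "1/2 < l" "l \<le> 1" and n0: "1 \<le> n0"
    and Q: "markov_projection f Q" and QP: "Q = Q \<circ> P"
    and minor: "\<forall>x \<in> base_set f. \<exists>u. 0 \<le> u \<and> l \<le> norm u \<and> u \<le> (T ^^ n0) x \<and> u \<le> Q x"
    using D by - ((elim conjE, assumption)+)
  have Q: "markov_operator f Q" using Q by (simp add: markov_projection_def)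
  define q where "q = 2 * (1 - l)"
  \<comment> \<open>The condition \<open>1/2 < l\<close> is exactly what makes this factor less than
    1.\<close>
  have q: "0 \<le> q" "q < 1" using l by (auto simp: q_def)
  have step: "norm ((T ^^ n0) x) \<le> q * norm x" if "P x = 0" for x
    unfolding q_def
  proof (rule common_lower_bound_contraction[OF markov_funpow[OF assms(3)] Q l(2) bspec[OF minor]])
    show "f x = 0"
      using that markov_functional[OF P, of x] linear_0[OF linear_functional] by simp
    have "linear Q" using Q by (simp add: markov_operator_def)
    then show "Q x = 0" using that linear_0[of Q] fun_cong[OF QP, of x] by simp
  qed
  have iter: "norm ((T ^^ (k * n0)) x) \<le> q ^ k * norm x" if x: "P x = 0" for k x
  proof (induction k)
    case (Suc k)
    have "norm ((T ^^ (Suc k * n0)) x) = norm ((T ^^ n0) ((T ^^ (k * n0)) x))"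
      by (simp add: funpow_add)
    also have "\<dots> \<le> q * norm ((T ^^ (k * n0)) x)" using x by (intro step) (simp add: PTn)
    also have "\<dots> \<le> q * (q ^ k * norm x)" using Suc q(1) by (rule mult_left_mono)
    finally show ?case by (simp add: mult.assoc)
  qed simp
  \<comment> \<open>Split \<open>n\<close> into \<open>n div n0\<close> blocks of length
    \<open>n0\<close>, each gaining a factor \<open>q\<close>, and a remainder that is a
    contraction. The constant 2 bounds \<open>norm (x - P x)\<close> by
    \<open>2 * norm x\<close>.\<close>
  have bound: "norm ((T ^^ n) x - P x) \<le> 2 * q ^ (n div n0) * norm x" for n x
  proof -
    have "(T ^^ n) x - P x = (T ^^ n) (x - P x)"
      by (simp add: linear_diff[OF linTn] TnP)
    also have "\<dots> = (T ^^ (n mod n0)) ((T ^^ (n div n0 * n0)) (x - P x))"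
      using funpow_add[of "n mod n0" "n div n0 * n0" T] by simp
    finally have "norm ((T ^^ n) x - P x) \<le> norm ((T ^^ (n div n0 * n0)) (x - P x))"
      using markov_contraction[OF markov_funpow[OF assms(3)]] by simp
    also have "\<dots> \<le> q ^ (n div n0) * norm (x - P x)"
      by (rule iter) (simp add: linear_diff[OF linP] PP)
    also have "\<dots> \<le> q ^ (n div n0) * (2 * norm x)"
      using norm_triangle_ineq4[of x "P x"] markov_contraction[OF P, of x] q
      by (intro mult_left_mono) auto
    finally show ?thesis by simp
  qed
  \<comment> \<open>Boundedness ensures that \<open>onorm\<close> is a genuine supremum, hence
    nonnegative: the lower half of the sandwich.\<close>
  have "bounded_linear (\<lambda>x. (T ^^ n) x - P x)" for n
  proof (rule bounded_linear_intro)
    show "norm ((T ^^ n) x - P x) \<le> norm x * (2 * q ^ (n div n0))" for x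
      using bound[of n x] by (simp add: mult.commute)
  qed (simp_all add: linear_add[OF linTn] linear_add[OF linP] linear_scale[OF linTn]
      linear_scale[OF linP] scaleR_diff_right)
  then have nonneg: "0 \<le> onorm (\<lambda>x. (T ^^ n) x - P x)" for n
    by (rule onorm_pos_le)
  have le: "onorm (\<lambda>x. (T ^^ n) x - P x) \<le> 2 * q ^ (n div n0)" for n
    by (rule onorm_bound) (use bound q in auto)
  have "filterlim (\<lambda>n. n div n0) at_top sequentially"
    unfolding filterlim_at_top eventually_sequentially
  proof (intro allI exI impI)
    \<comment> \<open>The threshold for \<open>n div n0\<close> to reach \<open>Z\<close> is
      \<open>Z * n0\<close>.\<close>
    fix Z n :: nat assume "Z * n0 \<le> n"
    then show "Z \<le> n div n0" using n0 by (simp add: less_eq_div_iff_mult_less_eq)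
  qed
  then have "(\<lambda>n. q ^ (n div n0)) \<longlonglongrightarrow> 0"
    using filterlim_compose[OF LIMSEQ_realpow_zero[OF q]] by blast
  then have lim: "(\<lambda>n. 2 * q ^ (n div n0)) \<longlonglongrightarrow> 0" by (rule tendsto_mult_right_zero)
  show ?thesis
    unfolding uniformly_P_ergodic_def
    by (rule tendsto_sandwich[OF always_eventually always_eventually tendsto_const lim])
      (simp_all add: nonneg le)
qed

end
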